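(* Let $\mathcal R=\langle R\mid\nu,\mu\rangle$ be an $(m_r,n_r)$-ring with a polyadic zero $z_R$, and let $\mathsf G=\langle G\mid\mu_{\mathsf G}\rangle$ be an $n_g$-ary group. Let $\ell_m,\ell_n,\ell_g\ge1$, $M=\ell_m(m_r-1)+1$ and $N=\ell_n(n_r-1)+1=\ell_g(n_g-1)+1$, and let $\langle S\mid\boldsymbol\nu,\boldsymbol\mu\rangle$ be the polyadic group ring with $M$-ary addition $\boldsymbol\nu$ and $N$-ary multiplication $\boldsymbol\mu$. Let $\mathrm z\in S$ be the formal sum all of whose coefficients equal $z_R$. Then $\mathrm z$ is a polyadic zero of the polyadic group ring, that is, for all $\mathrm r,\mathrm r_1,\dots,\mathrm r_{N-1}\in S$, $$\boldsymbol\nu[\mathrm r,\underbrace{\mathrm z,\ldots,\mathrm z}_{M-1}]=\mathrm r,\qquad \boldsymbol\mu[\mathrm r_1,\ldots,\mathrm r_{N-1},\mathrm z]=\mathrm z,$$ and likewise with $\mathrm z$ in any other position of $\boldsymbol\mu$ (and $\mathrm r$ in any other position of $\boldsymbol\nu$); moreover such an element of $S$ is unique.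
   Context: All arities are integers $\ge 2$. An $n$-ary operation $\mu:X^n\to X$ is totally associative if, for all $x_1,\dots,x_{2n-1}\in X$, the value $\mu[x_1,\dots,x_{i-1},\mu[x_i,\dots,x_{i+n-1}],x_{i+n},\dots,x_{2n-1}]$ does not depend on $i\in\{1,\dots,n\}$; then $\langle X\mid\mu\rangle$ is an $n$-ary semigroup. For $\ell\ge1$, $\mu^{\circ\ell}$ denotes the $\ell$-fold composition of $\mu$ with itself (by associativity the bracketing is irrelevant); it takes exactly $\ell(n-1)+1$ arguments. An $n$-ary group is an $n$-ary semigroup in which (for $n\ge3$) every $x$ has a querelement $\bar x$, i.e. $\mu[\bar x,x,\dots,x]=x$ with $\bar x$ in any of the $n$ positions; for $n=2$ it is an ordinary group. An $(m_r,n_r)$-ring $\langle R\mid\nu,\mu\rangle$ is a set with an $m_r$-ary addition $\nu$ making $R$ a commutative $m_r$-ary group, and an $n_r$-ary multiplication $\mu$ making $R$ an $n_r$-ary semigroup, such that $\mu$ distributes over $\nu$ in each of its $n_r$ arguments. A polyadic zero of $\mathcal R$ is an element $z_R\in R$ with $\nu[r,z_R,\dots,z_R]=r$ for all $r$ and with $\mu[r_1,\dots,r_{n_r}]=z_R$ whenever some $r_i=z_R$. Polyadic group ring: $S$ is the set of formal sums $\sum_{g\in G}r_g\bullet g$, i.e. families $(r_g)_{g\in G}$ in $R$ with all but finitely many $r_g$ equal to $z_R$. Addition is componentwise: $$\boldsymbol\nu\Big[\sum_{g} r_g(1)\bullet g,\ldots,\sum_g r_g(M)\bullet g\Big]=\sum_g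 \nu^{\circ \ell_m}\big[r_g(1),\ldots,r_g(M)\big]\bullet g .$$ Multiplication is the convolution $$\boldsymbol\mu\Big[\sum_{g} r_g(1)\bullet g,\ldots,\sum_g r_g(N)\bullet g\Big]=\sum_{g_1\in G}\cdots\sum_{g_N\in G}\mu^{\circ\ell_n}\big[r_{g_1}(1),\ldots,r_{g_N}(N)\big]\bullet\mu_{\mathsf G}^{\circ\ell_g}\big[g_1,\ldots,g_N\big],$$ where the coefficients of terms with the same group element are gathered by an iterate of $\nu$ (terms with coefficient $z_R$ being added or dropped so that the number of summands has the form $\ell(m_r-1)+1$). *)

theory Defs
  imports "HOL-Algebra.Group" "HOL-Library.Multiset" "HOL-Library.FuncSet"
begin

(* An n-ary operation is a function on lists, only ever constrained on lists of length n. *)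

definition tuples :: "nat \<Rightarrow> 'a set \<Rightarrow> 'a list set" where
  "tuples n X = {xs. set xs \<subseteq> X \<and> length xs = n}"

definition totally_assoc :: "nat \<Rightarrow> 'a set \<Rightarrow> ('a list \<Rightarrow> 'a) \<Rightarrow> bool" where
  "totally_assoc n X f \<longleftrightarrow>
     (\<forall>xs \<in> tuples (2 * n - 1) X. \<forall>i<n. \<forall>j<n.
        f (take i xs @ f (take n (drop i xs)) # drop (i + n) xs) =
        f (take j xs @ f (take n (drop j xs)) # drop (j + n) xs))"

definition nary_semigroup :: "nat \<Rightarrow> 'a set \<Rightarrow> ('a list \<Rightarrow> 'a) \<Rightarrow> bool" where
  "nary_semigroup n X f \<longleftrightarrow>
     2 \<le> n \<and> (\<forall>xs \<in> tuples n X. f xs \<in> X) \<and> totally_assoc n X f"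

(* q is a querelement of x: f[x,..,q,..,x] = x with q in any of the n positions. *)
definition querelement :: "nat \<Rightarrow> ('a list \<Rightarrow> 'a) \<Rightarrow> 'a \<Rightarrow> 'a \<Rightarrow> bool" where
  "querelement n f x q \<longleftrightarrow> (\<forall>i<n. f ((replicate n x)[i := q]) = x)"

definition nary_group :: "nat \<Rightarrow> 'a set \<Rightarrow> ('a list \<Rightarrow> 'a) \<Rightarrow> bool" where
  "nary_group n X f \<longleftrightarrow>
     nary_semigroup n X f \<and>
     (if n = 2
      then \<exists>e. group \<lparr>carrier = X, monoid.mult = (\<lambda>x y. f [x, y]), one = e\<rparr>
      else \<forall>x\<in>X. \<exists>q\<in>X. querelement n f x q)"

definition nary_commutative :: "nat \<Rightarrow> 'a set \<Rightarrow> ('a list \<Rightarrow> 'a) \<Rightarrow> bool" where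
  "nary_commutative n X f \<longleftrightarrow>
     (\<forall>xs \<in> tuples n X. \<forall>ys \<in> tuples n X. mset xs = mset ys \<longrightarrow> f xs = f ys)"

definition nary_distributive ::
    "nat \<Rightarrow> nat \<Rightarrow> 'a set \<Rightarrow> ('a list \<Rightarrow> 'a) \<Rightarrow> ('a list \<Rightarrow> 'a) \<Rightarrow> bool" where
  "nary_distributive m n X add mul \<longleftrightarrow>
     (\<forall>as \<in> tuples n X. \<forall>ys \<in> tuples m X. \<forall>i<n.
        mul (as[i := add ys]) = add (map (\<lambda>y. mul (as[i := y])) ys))"

definition polyadic_ring ::
    "nat \<Rightarrow> nat \<Rightarrow> 'a set \<Rightarrow> ('a list \<Rightarrow> 'a) \<Rightarrow> ('a list \<Rightarrow> 'a) \<Rightarrow> bool" where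
  "polyadic_ring m n R add mul \<longleftrightarrow>
     nary_group m R add \<and> nary_commutative m R add \<and>
     nary_semigroup n R mul \<and> nary_distributive m n R add mul"

definition polyadic_zero ::
    "nat \<Rightarrow> nat \<Rightarrow> 'a set \<Rightarrow> ('a list \<Rightarrow> 'a) \<Rightarrow> ('a list \<Rightarrow> 'a) \<Rightarrow> 'a \<Rightarrow> bool" where
  "polyadic_zero m n R add mul z \<longleftrightarrow>
     z \<in> R \<and>
     (\<forall>r\<in>R. add (r # replicate (m - 1) z) = r) \<and>
     (\<forall>rs \<in> tuples n R. z \<in> set rs \<longrightarrow> mul rs = z)"

(* The l-fold composition of an n-ary f with itself, bracketed from the left, applied to a
   list of length l * (n - 1) + 1; the case l = 0 is the identity on one-element lists. *)
fun nary_iter :: "nat \<Rightarrow> ('a list \<Rightarrow> 'a) \<Rightarrow> nat \<Rightarrow> 'a list \<Rightarrow> 'a" where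
  "nary_iter n f 0 xs = hd xs"
| "nary_iter n f (Suc l) xs =
     f (nary_iter n f l (take (l * (n - 1) + 1) xs) # drop (l * (n - 1) + 1) xs)"

(* Sum of a family c over an index set I on which c is different from z only finitely often:
   list the indices with c i different from z, pad with copies of z up to an admissible
   length, and apply the iterate of add. If add is commutative and associative and z is
   neutral for it, the value depends neither on the listing nor on the padding. *)
definition gather ::
    "nat \<Rightarrow> ('a list \<Rightarrow> 'a) \<Rightarrow> 'a \<Rightarrow> ('i \<Rightarrow> 'a) \<Rightarrow> 'i set \<Rightarrow> 'a" where
  "gather m add z c I =
     (THE s. \<exists>is k l. distinct is \<and> set is = {i \<in> I. c i \<noteq> z} \<and>
        length is + k = l * (m - 1) + 1 \<and>
        s = nary_iter m add l (map c is @ replicate k z))"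

(* Formal sums over G with coefficients in R; as elements of the extensional function space
   they are determined by their coefficients on G. *)
definition formal_sums :: "'g set \<Rightarrow> 'r set \<Rightarrow> 'r \<Rightarrow> ('g \<Rightarrow> 'r) set" where
  "formal_sums G R z = {r \<in> G \<rightarrow>\<^sub>E R. finite {g \<in> G. r g \<noteq> z}}"

definition group_ring_add ::
    "'g set \<Rightarrow> nat \<Rightarrow> ('r list \<Rightarrow> 'r) \<Rightarrow> nat \<Rightarrow> ('g \<Rightarrow> 'r) list \<Rightarrow> ('g \<Rightarrow> 'r)" where
  "group_ring_add G m add lm rs = (\<lambda>g\<in>G. nary_iter m add lm (map (\<lambda>r. r g) rs))"

(* The coefficient at g gathers the coefficients of all tuples [g_1,...,g_N] whose product
   in G is g, where N is the number of factors. *)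
definition group_ring_mult ::
    "nat \<Rightarrow> 'g set \<Rightarrow> ('g list \<Rightarrow> 'g) \<Rightarrow> nat \<Rightarrow>
     nat \<Rightarrow> ('r list \<Rightarrow> 'r) \<Rightarrow> 'r \<Rightarrow> nat \<Rightarrow> ('r list \<Rightarrow> 'r) \<Rightarrow> nat \<Rightarrow>
     ('g \<Rightarrow> 'r) list \<Rightarrow> ('g \<Rightarrow> 'r)" where
  "group_ring_mult ng G gmul lg m add z n mul ln rs =
     (\<lambda>g\<in>G. gather m add z
        (\<lambda>gs. nary_iter n mul ln (map2 (\<lambda>r h. r h) rs gs))
        {gs \<in> tuples (length rs) G. nary_iter ng gmul lg gs = g})"

end

theory Submission
  imports Defs
begin

text \<open>
  Both identities are checked coefficientwise, and each reduces to a fact about an iterate of one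
  operation of \<open>R\<close> that is proved by induction on the number of compositions.
  Each coefficient of an \<open>M\<close>-fold sum with a single summand other than \<open>z\<close> is an iterated sum of one
  element and copies of \<open>zR\<close>. At each step of the left bracketing at most one argument of
  \<open>add\<close> differs from \<open>zR\<close>, and commutativity moves it to the front, where the neutrality of \<open>zR\<close>
  absorbs the others (\<open>nary_iter_neutral\<close>). In a convolution with a factor \<open>z\<close>, every product of
  coefficients has a factor \<open>zR\<close>, hence equals \<open>zR\<close>, since absorption passes to iterates
  (\<open>nary_iter_absorbing\<close>); so each coefficient gathers the empty family, and an empty sum is \<open>zR\<close>
  however much padding is used (\<open>gather_trivial\<close>).

  Uniqueness is the usual argument for absorbing elements: the product of \<open>z'\<close> and \<open>N - 1 \<ge> 1\<close>
  copies of \<open>z\<close> equals both \<open>z\<close> and \<open>z'\<close>.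
\<close>

lemma polyadic_zero_unique:
  assumes z: "polyadic_zero m n X add mul z" and z': "polyadic_zero m n X add mul z'"
    and n: "2 \<le> n"
  shows "z' = z"
proof -
  let ?xs = "z' # replicate (n - 1) z"
  have "?xs \<in> tuples n X" "z \<in> set ?xs" "z' \<in> set ?xs"
    using z z' n by (auto simp: polyadic_zero_def tuples_def)
  then show ?thesis
    using z z' unfolding polyadic_zero_def by metis
qed

lemma nary_iter_closed:
  assumes "\<forall>xs \<in> tuples n X. f xs \<in> X" "1 \<le> n" "xs \<in> tuples (l * (n - 1) + 1) X"
  shows "nary_iter n f l xs \<in> X"
  using assms(3)
proof (induction l arbitrary: xs)
  case 0
  then show ?case by (cases xs) (auto simp: tuples_def)
next
  case (Suc l)
  let ?k = "l * (n - 1) + 1"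
  have "take ?k xs \<in> tuples ?k X"
    using Suc.prems by (auto simp: tuples_def dest: in_set_takeD)
  then have "nary_iter n f l (take ?k xs) \<in> X" by (rule Suc.IH)
  then have "nary_iter n f l (take ?k xs) # drop ?k xs \<in> tuples n X"
    using Suc.prems assms(2) by (auto simp: tuples_def dest: in_set_dropD)
  then show ?case using assms(1) by simp
qed

text \<open>
  The entry \<open>z\<close> lies either in the inner composition, whose value is then \<open>z\<close> by
  induction, or among the remaining arguments of the outermost operation.
\<close>

lemma nary_iter_absorbing:
  assumes closed: "\<forall>xs \<in> tuples n X. f xs \<in> X" and n: "1 \<le> n"
    and absorbing: "\<forall>xs \<in> tuples n X. z \<in> set xs \<longrightarrow> f xs = z"
    and "xs \<in> tuples (l * (n - 1) + 1) X" "z \<in> set xs"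
  shows "nary_iter n f l xs = z"
  using assms(4,5)
proof (induction l arbitrary: xs)
  case 0
  then show ?case by (cases xs) (auto simp: tuples_def)
next
  case (Suc l)
  let ?k = "l * (n - 1) + 1"
  let ?v = "nary_iter n f l (take ?k xs)"
  have take_tuple: "take ?k xs \<in> tuples ?k X"
    using Suc.prems by (auto simp: tuples_def dest: in_set_takeD)
  then have "?v \<in> X" by (rule nary_iter_closed[OF closed n])
  then have "?v # drop ?k xs \<in> tuples n X"
    using Suc.prems n by (auto simp: tuples_def dest: in_set_dropD)
  moreover have "z \<in> set (take ?k xs) \<or> z \<in> set (drop ?k xs)"
    using Suc.prems(2) by (metis Un_iff append_take_drop_id set_append)
  then have "z \<in> set (?v # drop ?k xs)"
    using Suc.IH[OF take_tuple] by auto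
  ultimately show ?case using absorbing by simp
qed

lemma nary_iter_replicate:
  assumes "f (replicate n z) = z" "1 \<le> n"
  shows "nary_iter n f l (replicate (l * (n - 1) + 1) z) = z"
proof (induction l)
  case (Suc l)
  have "z # replicate (n - 1) z = replicate n z"
    using assms(2) by (cases n) auto
  with Suc assms show ?case by (simp add: min_def)
qed simp

text \<open>
  Commutativity is what allows the entry \<open>a\<close> to stand in any position, since \<open>z\<close> is
  assumed to be neutral only for a first argument.
\<close>

lemma nary_iter_neutral:
  assumes comm: "nary_commutative n X f" and n: "1 \<le> n"
    and neutral: "\<forall>x\<in>X. f (x # replicate (n - 1) z) = x"
    and X: "z \<in> X" "a \<in> X"
    and "i < l * (n - 1) + 1"
  shows "nary_iter n f l ((replicate (l * (n - 1) + 1) z)[i := a]) = a"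
  using assms(6)
proof (induction l arbitrary: i)
  case 0
  then show ?case by simp
next
  case (Suc l)
  define k where "k = l * (n - 1) + 1"
  let ?xs = "(replicate (k + (n - 1)) z)[i := a]"
  have length_eq: "Suc l * (n - 1) + 1 = k + (n - 1)"
    by (simp add: k_def)
  have iter_Suc: "nary_iter n f (Suc l) ?xs = f (nary_iter n f l (take k ?xs) # drop k ?xs)"
    by (simp add: k_def)
  have fz: "f (replicate n z) = z"
    using neutral X n by (cases n) auto
  have "nary_iter n f (Suc l) ?xs = a"
  proof (cases "i < k")
    case True
    have "take k ?xs = (replicate k z)[i := a]"
      by (simp add: take_update_swap min_def)
    moreover have "drop k ?xs = replicate (n - 1) z"
      using True by simp
    ultimately show ?thesis
      using Suc.IH[of i, folded k_def] True neutral X iter_Suc by simp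
  next
    case False
    define j where "j = i - k"
    have j: "j < n - 1" using False Suc.prems unfolding j_def length_eq by simp
    have "take k ?xs = replicate k z"
      using False by (simp add: min_def)
    moreover have "drop k ?xs = (replicate (n - 1) z)[j := a]"
      using False by (simp add: drop_update_swap j_def)
    ultimately have "nary_iter n f (Suc l) ?xs = f (z # (replicate (n - 1) z)[j := a])"
      using nary_iter_replicate[of f n z l, OF fz n, folded k_def] iter_Suc by simp
    also have "\<dots> = f (a # replicate (n - 1) z)"
    proof -
      have "z # (replicate (n - 1) z)[j := a] \<in> tuples n X" "a # replicate (n - 1) z \<in> tuples n X"
        using X n set_update_subset_insert[of "replicate (n - 1) z" j a]
        by (auto simp: tuples_def)
      moreover have "mset (z # (replicate (n - 1) z)[j := a]) = mset (a # replicate (n - 1) z)"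
        using j by (simp add: mset_update)
      ultimately show ?thesis using comm unfolding nary_commutative_def by blast
    qed
    finally show ?thesis using neutral X by simp
  qed
  then show ?case by (simp only: length_eq)
qed

lemma gather_trivial:
  assumes "add (replicate m z) = z" "1 \<le> m" and c: "\<And>i. i \<in> I \<Longrightarrow> c i = z"
  shows "gather m add z c I = z"
  unfolding gather_def
proof (rule the_equality)
  \<comment> \<open>The shortest admissible padding: a single \<open>z\<close> and no addition.\<close>
  have "nary_iter m add 0 (map c [] @ replicate 1 z) = z" by simp
  then show "\<exists>is k l. distinct is \<and> set is = {i \<in> I. c i \<noteq> z} \<and>
      length is + k = l * (m - 1) + 1 \<and> z = nary_iter m add l (map c is @ replicate k z)"
    using c by (intro exI[of _ "[]"] exI[of _ 1] exI[of _ 0]) auto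
next
  fix s
  assume "\<exists>is k l. distinct is \<and> set is = {i \<in> I. c i \<noteq> z} \<and>
      length is + k = l * (m - 1) + 1 \<and> s = nary_iter m add l (map c is @ replicate k z)"
  then obtain "is" k l where "set is = {i \<in> I. c i \<noteq> z}"
      "length is + k = l * (m - 1) + 1" "s = nary_iter m add l (map c is @ replicate k z)"
    by blast
  moreover from this c have "set is = {}" by auto
  then have "is = []" by simp
  ultimately have "s = nary_iter m add l (replicate (l * (m - 1) + 1) z)" by simp
  then show "s = z"
    using nary_iter_replicate[of add m z l, OF assms(1,2)] by simp
qed

theorem mainTheorem6:
  fixes R :: "'r set" and add mul :: "'r list \<Rightarrow> 'r" and zR :: 'r
    and G :: "'g set" and gmul :: "'g list \<Rightarrow> 'g"
    and mr nr ng lm ln lg M N :: nat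
    and S :: "('g \<Rightarrow> 'r) set" and Add Mul :: "('g \<Rightarrow> 'r) list \<Rightarrow> ('g \<Rightarrow> 'r)"
    and z :: "'g \<Rightarrow> 'r"
  assumes "polyadic_ring mr nr R add mul"
    and "polyadic_zero mr nr R add mul zR"
    and "nary_group ng G gmul"
    and "lm \<ge> 1" and "ln \<ge> 1" and "lg \<ge> 1"
    and "M = lm * (mr - 1) + 1"
    and "N = ln * (nr - 1) + 1"
    and "N = lg * (ng - 1) + 1"
    and "S = formal_sums G R zR"
    and "Add = group_ring_add G mr add lm"
    and "Mul = group_ring_mult ng G gmul lg mr add zR nr mul ln"
    and "z = (\<lambda>g\<in>G. zR)"
  shows "polyadic_zero M N S Add Mul z \<and>
    (\<forall>r\<in>S. \<forall>i<M. Add ((replicate M z)[i := r]) = r) \<and>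
    (\<forall>rs \<in> tuples (N - 1) S. \<forall>i<N. Mul (take i rs @ z # drop i rs) = z) \<and>
    (\<forall>z'. polyadic_zero M N S Add Mul z' \<longrightarrow> z' = z)"
proof -
  note [simp] = assms(10-13)
  have mr: "2 \<le> mr" and nr: "2 \<le> nr"
    and comm: "nary_commutative mr R add"
    and mul_closed: "\<forall>xs \<in> tuples nr R. mul xs \<in> R"
    using assms(1)
    by (auto simp: polyadic_ring_def nary_group_def nary_semigroup_def)
  have zR: "zR \<in> R"
    and neutral: "\<forall>r\<in>R. add (r # replicate (mr - 1) zR) = r"
    and absorbing: "\<forall>rs \<in> tuples nr R. zR \<in> set rs \<longrightarrow> mul rs = zR"
    using assms(2) by (auto simp: polyadic_zero_def)
  have add_zR: "add (replicate mr zR) = zR"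
    using neutral zR mr by (cases mr) auto
  have N: "2 \<le> N"
    using assms(5,8) nr by (cases ln) auto
  have zS: "z \<in> S"
    using zR by (auto simp: formal_sums_def)

  have Add_z: "Add ((replicate M z)[i := r]) = r" if r: "r \<in> S" and i: "i < M" for r i
  proof
    fix g
    show "Add ((replicate M z)[i := r]) g = r g"
    proof (cases "g \<in> G")
      case True
      then have "r g \<in> R" using r by (auto simp: formal_sums_def)
      then have "nary_iter mr add lm ((replicate M zR)[i := r g]) = r g"
        using nary_iter_neutral[OF comm _ neutral zR, of "r g" i lm] mr i assms(7) by simp
      with True show ?thesis by (simp add: group_ring_add_def map_update)
    next
      case False
      then show ?thesis
        using r by (auto simp: group_ring_add_def formal_sums_def PiE_def extensional_def)
    qed
  qed

  have Mul_z: "Mul rs = z" if rs: "rs \<in> tuples N S" and z: "z \<in> set rs" for rs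
  proof -
    have coeff: "nary_iter nr mul ln (map2 (\<lambda>r h. r h) rs gs) = zR"
      if gs: "gs \<in> tuples (length rs) G" for gs
    proof (rule nary_iter_absorbing[OF mul_closed _ absorbing])
      have len: "length rs = N" "length gs = N"
        using rs gs by (auto simp: tuples_def)
      have "r h \<in> R" if "(r, h) \<in> set (zip rs gs)" for r h
      proof -
        have "r \<in> S" "h \<in> G"
          using that rs gs by (auto simp: tuples_def dest: set_zip_leftD set_zip_rightD)
        then show ?thesis by (auto simp: formal_sums_def)
      qed
      then show "map2 (\<lambda>r h. r h) rs gs \<in> tuples (ln * (nr - 1) + 1) R"
        using len assms(8) by (auto simp: tuples_def)
      obtain j where j: "j < N" "rs ! j = z"
        using z len by (auto simp: in_set_conv_nth)
      then have "gs ! j \<in> G"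
        using gs len by (auto simp: tuples_def)
      then have "map2 (\<lambda>r h. r h) rs gs ! j = zR"
        using j len by simp
      then show "zR \<in> set (map2 (\<lambda>r h. r h) rs gs)"
        using j len by (metis length_map length_zip min.idem nth_mem)
    qed (use nr in simp)
    have "gather mr add zR (\<lambda>gs. nary_iter nr mul ln (map2 (\<lambda>r h. r h) rs gs))
        {gs \<in> tuples (length rs) G. nary_iter ng gmul lg gs = g} = zR" for g
      by (rule gather_trivial[where add = add, OF add_zR]) (use mr coeff in auto)
    then show ?thesis by (simp add: group_ring_mult_def)
  qed

  have zero: "polyadic_zero M N S Add Mul z"
    unfolding polyadic_zero_def
  proof (intro conjI ballI impI)
    fix r assume "r \<in> S"
    moreover have "(replicate M z)[0 := r] = r # replicate (M - 1) z"
      using assms(7) by simp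
    ultimately show "Add (r # replicate (M - 1) z) = r"
      using Add_z[of r 0] assms(7) by (simp only: )
  qed (use zS Mul_z in auto)
  moreover have "Mul (take i rs @ z # drop i rs) = z"
    if "rs \<in> tuples (N - 1) S" "i < N" for rs i
  proof (rule Mul_z)
    show "take i rs @ z # drop i rs \<in> tuples N S"
      using that zS N by (auto simp: tuples_def dest: in_set_takeD in_set_dropD)
  qed simp
  ultimately show ?thesis
    using Add_z polyadic_zero_unique[OF zero _ N] by blast
qed

end
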